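(* For any $a \in \mathbb{N}$ and any integer $b \ge 2$, the reflective Ramsey number of the start-central star $S_a^{\mathrm{sc}}$ versus the monotone cycle $C_b^{\mathrm{mon}}$ satisfies $$R_{\mathrm{ref}}(S_a^{\mathrm{sc}}, C_b^{\mathrm{mon}}) = 1 + (a-1)(b-1).$$
   Context: $\mathbb{N}=\{1,2,3,\ldots\}$. All graphs are undirected, simple and finite, with vertex set $\{0,1,\ldots,n-1\}$ for some $n\in\mathbb{N}$; $|G|$ denotes the order of $G$. $K_n$ is the complete graph on $n$ vertices. A $k$-edge-coloring of a graph is a map from its edge set to $\{1,\ldots,k\}$. For graphs $G,H$ and a permutation group $\Gamma$ on $V(H)$, $H$ is $\Gamma$-embeddable in $G$ if there is a graph homomorphism from $H$ to $G$ of the form $\psi\circ\varphi$, where $\varphi\in\Gamma$ and $\psi\colon V(H)\to V(G)$ is an increasing injection. For graphs $H_1,\ldots,H_k$ and permutation groups $\Gamma_1,\ldots,\Gamma_k$ on their respective vertex sets, the permutational Ramsey number $R(H_1^{\Gamma_1},\ldots,H_k^{\Gamma_k})$ is the minimum $n\in\mathbb{N}$ such that for every $k$-edge-coloring of $K_n$ there is some $j$ for which $H_j$ is $\Gamma_j$-embeddable in the spanning subgraph of $K_n$ comprising the edges of color $j$. The reflective Ramsey number $R_{\mathrm{ref}}(H_1,\ldots,H_k)$ is the permutational Ramsey number in which each $\Gamma_j$ is the group generated by the reflection $x\mapsto |H_j|-1-x$ of $V(H_j)$. For $n\in\mathbb{N}$, the start-central star $S^{\mathrm{sc}}_n$ is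 the star graph of order $n$ in which vertex $0$ is adjacent to all the other vertices (and there are no other edges). For $n\ge 3$, the monotone cycle $C^{\mathrm{mon}}_n$ is the graph of order $n$ whose edges are the pairs of consecutive integers together with the edge $\{0,n-1\}$; also $C^{\mathrm{mon}}_2 := K_2$. *)

theory Defs
  imports "HOL-Algebra.Bij" "HOL-Algebra.Generated_Groups" "HOL-Library.Ramsey"
begin

record ograph =
  ord_of :: nat
  edges :: "nat set set"

definition verts :: "ograph \<Rightarrow> nat set" where
  "verts G = {..<ord_of G}"

definition is_ograph :: "ograph \<Rightarrow> bool" where
  "is_ograph G \<longleftrightarrow> 1 \<le> ord_of G \<and> edges G \<subseteq> nsets (verts G) 2"

definition complete_graph :: "nat \<Rightarrow> ograph" where
  "complete_graph n = \<lparr>ord_of = n, edges = nsets {..<n} 2\<rparr>"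

definition edge_coloring :: "nat \<Rightarrow> ograph \<Rightarrow> (nat set \<Rightarrow> nat) \<Rightarrow> bool" where
  "edge_coloring k G c \<longleftrightarrow> c \<in> edges G \<rightarrow> {1..k}"

definition color_subgraph :: "ograph \<Rightarrow> (nat set \<Rightarrow> nat) \<Rightarrow> nat \<Rightarrow> ograph" where
  "color_subgraph G c j = \<lparr>ord_of = ord_of G, edges = {e \<in> edges G. c e = j}\<rparr>"

definition graph_hom :: "ograph \<Rightarrow> ograph \<Rightarrow> (nat \<Rightarrow> nat) \<Rightarrow> bool" where
  "graph_hom H G f \<longleftrightarrow> f \<in> verts H \<rightarrow> verts G \<and> (\<forall>e \<in> edges H. f ` e \<in> edges G)"

text \<open>A permutation group on the vertex set of \<open>H\<close> is the carrier of a subgroup of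
  \<open>BijGroup (verts H)\<close>.\<close>

definition embeddable :: "ograph \<Rightarrow> (nat \<Rightarrow> nat) set \<Rightarrow> ograph \<Rightarrow> bool" where
  "embeddable H \<Gamma> G \<longleftrightarrow>
     (\<exists>\<phi> \<in> \<Gamma>. \<exists>\<psi>. \<psi> \<in> verts H \<rightarrow> verts G \<and> strict_mono_on (verts H) \<psi> \<and>
        graph_hom H G (\<psi> \<circ> \<phi>))"

text \<open>The colors are \<open>1, \<dots>, k\<close>, whereas list positions start at \<open>0\<close>.
  The infimum of a nonempty set of naturals is its minimum, and the infimum of the empty set
  is \<open>0\<close>, which is not a member of the set below; hence a positive value of the Ramsey number
  is attained.\<close>

definition perm_ramsey :: "(ograph \<times> (nat \<Rightarrow> nat) set) list \<Rightarrow> nat" where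
  "perm_ramsey Hs = Inf {n. 1 \<le> n \<and>
     (\<forall>c. edge_coloring (length Hs) (complete_graph n) c \<longrightarrow>
       (\<exists>j \<in> {1..length Hs}. embeddable (fst (Hs ! (j - 1))) (snd (Hs ! (j - 1)))
          (color_subgraph (complete_graph n) c j)))}"

definition reflection :: "ograph \<Rightarrow> nat \<Rightarrow> nat" where
  "reflection H = (\<lambda>x \<in> verts H. ord_of H - 1 - x)"

definition reflection_group :: "ograph \<Rightarrow> (nat \<Rightarrow> nat) set" where
  "reflection_group H = generate (BijGroup (verts H)) {reflection H}"

definition ref_ramsey :: "ograph list \<Rightarrow> nat" where
  "ref_ramsey Hs = perm_ramsey (map (\<lambda>H. (H, reflection_group H)) Hs)"

definition star_sc :: "nat \<Rightarrow> ograph" where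
  "star_sc n = \<lparr>ord_of = n, edges = {{0, i} | i. 0 < i \<and> i < n}\<rparr>"

text \<open>Only used for \<open>n \<ge> 2\<close>.\<close>

definition cycle_mon :: "nat \<Rightarrow> ograph" where
  "cycle_mon n =
     (if n = 2 then complete_graph 2
      else \<lparr>ord_of = n, edges = insert {0, n - 1} {{i, i + 1} | i. i + 1 < n}\<rparr>)"

lemma is_ograph_complete_graph: "1 \<le> n \<Longrightarrow> is_ograph (complete_graph n)"
  by (simp add: is_ograph_def complete_graph_def verts_def)

lemma is_ograph_color_subgraph: "is_ograph G \<Longrightarrow> is_ograph (color_subgraph G c j)"
  by (auto simp: is_ograph_def color_subgraph_def verts_def)

lemma is_ograph_star_sc: "1 \<le> n \<Longrightarrow> is_ograph (star_sc n)"
  by (auto simp: is_ograph_def star_sc_def verts_def nsets_def)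

lemma is_ograph_cycle_mon: "2 \<le> n \<Longrightarrow> is_ograph (cycle_mon n)"
  by (auto simp: is_ograph_def cycle_mon_def complete_graph_def verts_def nsets_def)

lemma reflection_in_Bij: "reflection H \<in> Bij (verts H)"
proof -
  have "bij_betw (reflection H) (verts H) (verts H)"
    by (rule bij_betw_byWitness[where f' = "reflection H"])
      (auto simp: reflection_def verts_def)
  then show ?thesis
    by (simp add: Bij_def reflection_def)
qed

lemma subgroup_reflection_group: "subgroup (reflection_group H) (BijGroup (verts H))"
  unfolding reflection_group_def
  by (rule group.generate_is_subgroup[OF group_BijGroup])
    (simp add: BijGroup_def reflection_in_Bij)

end

theory Submission imports Defs begin

text \<open>
  Write \<open>m = a - 1\<close>, call the edges of color 1 red and those of color 2 blue.

  For the lower bound, cut at most \<open>m * (b - 1)\<close> vertices into at most \<open>b - 1\<close> consecutive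
  blocks, each of at most \<open>m\<close> vertices, and let an edge be red exactly if it lies within a block.
  A red star, wherever its center, stays within the block of its center, which has fewer than
  \<open>a\<close> vertices (\<open>no_red_star\<close>). Along a blue monotone path the block number strictly increases,
  so the path has at most \<open>b - 1\<close> vertices; but the cycle, reflected or not, contains a
  monotone path on all its \<open>b\<close> vertices (\<open>no_blue_cycle\<close>).

  For the upper bound, embeddings by the identity are enough. On \<open>1 + m * (b - 1)\<close> vertices,
  if some vertex has \<open>m\<close> red neighbors to its right, then they form with it a red start-central
  star of order \<open>a\<close>. If no vertex has, choose vertices greedily: take the least one available
  and discard it together with its red right neighbors. A step removes at most \<open>m\<close> vertices, so
  \<open>b\<close> vertices can be chosen. They span a blue complete graph, which contains the cycle
  (\<open>ex_independent_of_few_right_neighbors\<close>).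
\<close>

section \<open>Reflective embeddings\<close>

text \<open>The reflection is an involution, so the group that it generates has no further elements
  than itself and the identity.\<close>

lemma reflection_group_cases:
  assumes "\<phi> \<in> reflection_group H"
  shows "\<phi> = (\<lambda>x\<in>verts H. x) \<or> \<phi> = reflection H"
proof -
  have refl2: "compose (verts H) (reflection H) (reflection H) = (\<lambda>x\<in>verts H. x)"
    by (auto simp: compose_def reflection_def verts_def fun_eq_iff)
  have r: "reflection H \<in> carrier (BijGroup (verts H))"
    by (simp add: BijGroup_def reflection_in_Bij)
  have idB: "(\<lambda>x\<in>verts H. x) \<in> Bij (verts H)"
    by (rule id_Bij)
  have mult: "g \<otimes>\<^bsub>BijGroup (verts H)\<^esub> h = compose (verts H) g h"
    if "g \<in> Bij (verts H)" "h \<in> Bij (verts H)" for g h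
    using that by (simp add: BijGroup_def)
  have "reflection H \<otimes>\<^bsub>BijGroup (verts H)\<^esub> reflection H = \<one>\<^bsub>BijGroup (verts H)\<^esub>"
    using refl2 by (simp add: BijGroup_def reflection_in_Bij)
  then have inv_refl: "inv\<^bsub>BijGroup (verts H)\<^esub> reflection H = reflection H"
    using group.inv_equality[OF group_BijGroup] r by blast
  have c1: "compose (verts H) (\<lambda>x\<in>verts H. x) (\<lambda>x\<in>verts H. x) = (\<lambda>x\<in>verts H. x)"
    "compose (verts H) (\<lambda>x\<in>verts H. x) (reflection H) = reflection H"
    "compose (verts H) (reflection H) (\<lambda>x\<in>verts H. x) = reflection H"
    by (auto simp: compose_def reflection_def verts_def fun_eq_iff)
  from assms show ?thesis
    unfolding reflection_group_def
  proof (induction rule: generate.induct)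
    case one
    then show ?case by (simp add: BijGroup_def)
  next
    case (incl h)
    then show ?case by simp
  next
    case (inv h)
    then show ?case using inv_refl by simp
  next
    case (eng h1 h2)
    then show ?case
      using refl2 c1 mult[OF idB idB] mult[OF idB reflection_in_Bij]
        mult[OF reflection_in_Bij idB] mult[OF reflection_in_Bij reflection_in_Bij]
      by metis
  qed
qed

lemma embeddable_of_increasing:
  assumes "\<psi> \<in> verts H \<rightarrow> verts G" "strict_mono_on (verts H) \<psi>"
    and "is_ograph H" "\<And>e. e \<in> edges H \<Longrightarrow> \<psi> ` e \<in> edges G"
  shows "embeddable H (reflection_group H) G"
proof -
  let ?i = "\<lambda>x\<in>verts H. x"
  have "?i \<in> reflection_group H"
    using generate.one[of "BijGroup (verts H)" "{reflection H}"]
    by (simp add: reflection_group_def BijGroup_def)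
  moreover have "(\<psi> \<circ> ?i) ` e = \<psi> ` e" if "e \<in> edges H" for e
  proof (rule image_cong[OF refl])
    fix x assume "x \<in> e"
    then have "x \<in> verts H"
      using that assms(3) by (auto simp: is_ograph_def nsets_def)
    then show "(\<psi> \<circ> ?i) x = \<psi> x" by simp
  qed
  then have "graph_hom H G (\<psi> \<circ> ?i)"
    using assms by (auto simp: graph_hom_def)
  ultimately show ?thesis
    using assms unfolding embeddable_def by blast
qed

lemma ord_of_cycle_mon [simp]: "ord_of (cycle_mon b) = b"
  by (simp add: cycle_mon_def complete_graph_def)

lemma ord_of_star_sc [simp]: "ord_of (star_sc a) = a"
  by (simp add: star_sc_def)

lemma embeddable_star_sc_of_right_neighbors:
  assumes "v < ord_of G" "W \<subseteq> {v<..<ord_of G}" "a - 1 \<le> card W" "1 \<le> a"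
    and adj: "\<And>w. w \<in> W \<Longrightarrow> {v, w} \<in> edges G"
  shows "embeddable (star_sc a) (reflection_group (star_sc a)) G"
proof -
  have "finite W" using assms(2) finite_subset by blast
  then obtain r where r: "strict_mono_on {..<card W} r" "\<And>n. n < card W \<Longrightarrow> r n \<in> W"
    using finite_enumerate by metis
  define \<psi> where "\<psi> i = (case i of 0 \<Rightarrow> v | Suc k \<Rightarrow> r k)" for i
  have rng: "r k \<in> W" "v < r k" "r k < ord_of G" if "Suc k < a" for k
  proof -
    show "r k \<in> W" using r(2)[of k] that assms(3) by simp
    then show "v < r k" "r k < ord_of G" using assms(2) by auto
  qed
  have vs: "verts (star_sc a) = {..<a}" by (simp add: verts_def)
  show ?thesis
  proof (rule embeddable_of_increasing)
    show "\<psi> \<in> verts (star_sc a) \<rightarrow> verts G"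
      using assms(1) rng by (auto simp: vs verts_def \<psi>_def split: nat.split)
    have "r k < r l" if "k < l" "Suc l < a" for k l
      by (rule strict_mono_onD[OF r(1)]) (use assms(3) that in auto)
    then show "strict_mono_on (verts (star_sc a)) \<psi>"
      using rng
      by (auto simp: vs \<psi>_def strict_mono_on_def split: nat.split)
    show "is_ograph (star_sc a)" using assms(4) by (rule is_ograph_star_sc)
    fix e assume "e \<in> edges (star_sc a)"
    then obtain i where "e = {0, i}" "0 < i" "i < a" by (auto simp: star_sc_def)
    then show "\<psi> ` e \<in> edges G"
      using rng(1)[of "i - 1"] adj by (auto simp: \<psi>_def split: nat.split)
  qed
qed

lemma edges_cycle_mon_subset: "2 \<le> b \<Longrightarrow> edges (cycle_mon b) \<subseteq> nsets {..<b} 2"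
  using is_ograph_cycle_mon[of b]
  by (auto simp: is_ograph_def verts_def cycle_mon_def complete_graph_def split: if_splits)

lemma consecutive_in_edges_cycle_mon: "Suc i < b \<Longrightarrow> {i, Suc i} \<in> edges (cycle_mon b)"
  by (auto simp: cycle_mon_def complete_graph_def nsets_def)

lemma embeddable_cycle_mon_of_clique:
  assumes "K \<subseteq> verts G" "card K = b" "2 \<le> b"
    and adj: "\<And>v w. v \<in> K \<Longrightarrow> w \<in> K \<Longrightarrow> v < w \<Longrightarrow> {v, w} \<in> edges G"
  shows "embeddable (cycle_mon b) (reflection_group (cycle_mon b)) G"
proof -
  have "finite K" using assms(1) finite_subset by (auto simp: verts_def)
  then obtain r where r: "strict_mono_on {..<b} r" "\<And>n. n < b \<Longrightarrow> r n \<in> K"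
    using finite_enumerate assms(2) by metis
  have vs: "verts (cycle_mon b) = {..<b}" by (simp add: verts_def)
  show ?thesis
  proof (rule embeddable_of_increasing)
    show "r \<in> verts (cycle_mon b) \<rightarrow> verts G" using r(2) assms(1) by (auto simp: vs)
    show "strict_mono_on (verts (cycle_mon b)) r" using r(1) by (simp add: vs)
    show "is_ograph (cycle_mon b)" using assms(3) by (rule is_ograph_cycle_mon)
    fix e assume "e \<in> edges (cycle_mon b)"
    then have "e \<in> nsets {..<b} 2" using edges_cycle_mon_subset[OF assms(3)] by blast
    then obtain i j where "e = {i, j}" "i < j" "i < b" "j < b"
      by (auto simp: nsets_def card_2_iff) (metis insert_commute linorder_neqE_nat)
    moreover from this have "r i < r j" using r(1) by (simp add: strict_mono_on_def)
    ultimately show "r ` e \<in> edges G" using r(2) adj by auto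
  qed
qed

section \<open>The upper bound\<close>

text \<open>This is the greedy choice: the least vertex is kept, and its right neighbors with respect
  to \<open>R\<close>, fewer than \<open>m\<close>, are discarded. Since all vertices that remain lie to the right of the one
  that was kept, bounding the right neighbors suffices.\<close>

lemma ex_independent_of_few_right_neighbors:
  fixes V :: "nat set" and R :: "nat \<Rightarrow> nat \<Rightarrow> bool"
  assumes "finite V" "m * k < card V"
    and "\<And>v. v \<in> V \<Longrightarrow> card {w \<in> V. v < w \<and> R v w} < m"
  shows "\<exists>K \<subseteq> V. card K = Suc k \<and> (\<forall>v\<in>K. \<forall>w\<in>K. v < w \<longrightarrow> \<not> R v w)"
  using assms
proof (induction k arbitrary: V)
  case 0
  then obtain x where "x \<in> V" by fastforce
  then show ?case by (intro exI[of _ "{x}"]) auto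
next
  case (Suc k)
  have "V \<noteq> {}" using Suc.prems(2) by auto
  define x where "x = Min V"
  have x: "x \<in> V" "\<And>y. y \<in> V \<Longrightarrow> x \<le> y"
    using Suc.prems(1) \<open>V \<noteq> {}\<close> by (auto simp: x_def)
  define D where "D = {w \<in> V. x < w \<and> R x w}"
  define V' where "V' = {w \<in> V. x < w \<and> \<not> R x w}"
  have fin: "finite V'" "finite D" using Suc.prems(1) by (auto simp: V'_def D_def)
  have "V = insert x (D \<union> V')" using x by (force simp: D_def V'_def)
  then have "card V \<le> Suc (card D + card V')"
    by (metis card_Un_le card_insert_le_m1 card_insert_if fin finite_UnI le_SucI not_less_eq_eq)
  moreover have "card D < m" using Suc.prems(3) x(1) by (simp add: D_def)
  ultimately have big: "m * k < card V'" using Suc.prems(2) by simp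
  have small: "card {w \<in> V'. v < w \<and> R v w} < m" if "v \<in> V'" for v
  proof -
    have "card {w \<in> V'. v < w \<and> R v w} \<le> card {w \<in> V. v < w \<and> R v w}"
      by (rule card_mono) (use Suc.prems(1) in \<open>auto simp: V'_def\<close>)
    also have "\<dots> < m" using Suc.prems(3) that by (simp add: V'_def)
    finally show ?thesis .
  qed
  obtain K where K: "K \<subseteq> V'" "card K = Suc k" "\<forall>v\<in>K. \<forall>w\<in>K. v < w \<longrightarrow> \<not> R v w"
    using Suc.IH[OF fin(1) big small] by blast
  have "x \<notin> K" "finite K" using K(1) fin(1) finite_subset by (auto simp: V'_def)
  then show ?case
    using K x(1) by (intro exI[of _ "insert x K"]) (force simp: V'_def)
qed

lemma red_star_or_blue_cycle:
  assumes "1 \<le> a" "2 \<le> b" "n = 1 + (a - 1) * (b - 1)"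
    and col: "edge_coloring 2 (complete_graph n) c"
  defines "G \<equiv> color_subgraph (complete_graph n) c"
  shows "embeddable (star_sc a) (reflection_group (star_sc a)) (G 1) \<or>
    embeddable (cycle_mon b) (reflection_group (cycle_mon b)) (G 2)"
proof (cases "\<exists>v<n. a - 1 \<le> card {w \<in> {..<n}. v < w \<and> c {v, w} = 1}")
  case True
  then obtain v where v: "v < n" "a - 1 \<le> card {w \<in> {..<n}. v < w \<and> c {v, w} = 1}" by blast
  have "embeddable (star_sc a) (reflection_group (star_sc a)) (G 1)"
    by (rule embeddable_star_sc_of_right_neighbors[OF _ _ v(2)])
      (use v(1) assms(1) in \<open>auto simp: G_def color_subgraph_def complete_graph_def nsets_def\<close>)
  then show ?thesis ..
next
  case False
  then have few: "card {w \<in> {..<n}. v < w \<and> c {v, w} = 1} < a - 1" if "v \<in> {..<n}" for v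
    using that by (meson lessThan_iff not_le)
  have "(a - 1) * (b - 1) < card {..<n}" using assms(3) by simp
  from ex_independent_of_few_right_neighbors[OF finite_lessThan this few] obtain K
    where K: "K \<subseteq> {..<n}" "card K = Suc (b - 1)"
      "\<forall>v\<in>K. \<forall>w\<in>K. v < w \<longrightarrow> c {v, w} \<noteq> 1"
    by blast
  have "embeddable (cycle_mon b) (reflection_group (cycle_mon b)) (G 2)"
  proof (rule embeddable_cycle_mon_of_clique)
    show "K \<subseteq> verts (G 2)"
      using K(1) by (simp add: G_def color_subgraph_def complete_graph_def verts_def)
    show "card K = b" using K(2) assms(2) by simp
    show "2 \<le> b" by fact
    fix v w assume vw: "v \<in> K" "w \<in> K" "v < w"
    then have e: "{v, w} \<in> edges (complete_graph n)"
      using K(1) by (auto simp: complete_graph_def nsets_def)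
    then have "c {v, w} \<in> {1..2}" using col by (auto simp: edge_coloring_def)
    then have "c {v, w} = 2" using K(3) vw by force
    then show "{v, w} \<in> edges (G 2)" using e by (simp add: G_def color_subgraph_def)
  qed
  then show ?thesis ..
qed

section \<open>The lower bound\<close>

definition block_coloring :: "nat \<Rightarrow> nat set \<Rightarrow> nat" where
  "block_coloring m e = (if \<exists>q. \<forall>x\<in>e. x div m = q then 1 else 2)"

lemma block_coloring_pair:
  "block_coloring m {x, y} = (if x div m = y div m then 1 else 2)"
  by (auto simp: block_coloring_def)

text \<open>Vertices of one block are told apart by their residues modulo \<open>m\<close>, so a block has no room
  for the \<open>a > m\<close> vertices of the star.\<close>

lemma no_red_star:
  assumes "1 \<le> m" "m < a"
  shows "\<not> embeddable (star_sc a) (reflection_group (star_sc a))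
    (color_subgraph (complete_graph n) (block_coloring m) 1)"
proof
  let ?H = "star_sc a"
  assume "embeddable ?H (reflection_group ?H)
    (color_subgraph (complete_graph n) (block_coloring m) 1)"
  then obtain \<phi> \<psi> where \<phi>: "\<phi> \<in> reflection_group ?H"
    and \<psi>: "strict_mono_on (verts ?H) \<psi>"
    and hom: "graph_hom ?H (color_subgraph (complete_graph n) (block_coloring m) 1) (\<psi> \<circ> \<phi>)"
    unfolding embeddable_def by blast
  have vs: "verts ?H = {..<a}" by (simp add: verts_def)
  have "\<phi> \<in> Bij (verts ?H)"
    using subgroup.subset[OF subgroup_reflection_group] \<phi> by (auto simp: BijGroup_def)
  then have bij: "bij_betw \<phi> {..<a} {..<a}" by (simp add: Bij_def vs)
  have inj: "inj_on (\<psi> \<circ> \<phi>) {..<a}"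
    using bij strict_mono_on_imp_inj_on[OF \<psi>] by (simp add: comp_inj_on bij_betw_def vs)
  have same: "(\<psi> \<circ> \<phi>) 0 div m = (\<psi> \<circ> \<phi>) i div m" if "i < a" for i
  proof (cases "i = 0")
    case False
    then have "{0, i} \<in> edges ?H" using that by (auto simp: star_sc_def)
    then have "block_coloring m {(\<psi> \<circ> \<phi>) 0, (\<psi> \<circ> \<phi>) i} = 1"
      using hom by (fastforce simp: graph_hom_def color_subgraph_def)
    then show ?thesis by (simp add: block_coloring_pair split: if_splits)
  qed simp
  have "inj_on (\<lambda>i. (\<psi> \<circ> \<phi>) i mod m) {..<a}"
  proof (rule inj_onI)
    fix i j assume ij: "i \<in> {..<a}" "j \<in> {..<a}" "(\<psi> \<circ> \<phi>) i mod m = (\<psi> \<circ> \<phi>) j mod m"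
    then have "(\<psi> \<circ> \<phi>) i div m = (\<psi> \<circ> \<phi>) j div m" using same by (metis lessThan_iff)
    then have "(\<psi> \<circ> \<phi>) i = (\<psi> \<circ> \<phi>) j" using ij(3) by (metis div_mult_mod_eq)
    then show "i = j" using inj ij by (meson inj_onD)
  qed
  then have "card {..<a} \<le> card {..<m}"
    by (rule card_inj_on_le) (use assms in auto)
  then show False using assms by simp
qed

text \<open>The reflection maps pairs of consecutive vertices to pairs of consecutive vertices.
  So the monotone path within the cycle makes \<open>\<psi>\<close> visit \<open>b\<close> blocks in
  increasing order, whichever group element precedes \<open>\<psi>\<close>.\<close>

lemma no_blue_cycle:
  assumes "1 \<le> b" "n \<le> m * (b - 1)"
  shows "\<not> embeddable (cycle_mon b) (reflection_group (cycle_mon b))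
    (color_subgraph (complete_graph n) (block_coloring m) 2)"
proof
  let ?H = "cycle_mon b"
  let ?G = "color_subgraph (complete_graph n) (block_coloring m) 2"
  assume "embeddable ?H (reflection_group ?H) ?G"
  then obtain \<phi> \<psi> where \<phi>: "\<phi> \<in> reflection_group ?H"
    and \<psi>: "\<psi> \<in> verts ?H \<rightarrow> verts ?G" "strict_mono_on (verts ?H) \<psi>"
    and hom: "graph_hom ?H ?G (\<psi> \<circ> \<phi>)"
    unfolding embeddable_def by blast
  have vs: "verts ?H = {..<b}" by (simp add: verts_def)
  have blue: "\<psi> i div m \<noteq> \<psi> (Suc i) div m" if i: "Suc i < b" for i
  proof -
    obtain j where j: "Suc j < b" "{\<phi> j, \<phi> (Suc j)} = {i, Suc i}"
      using reflection_group_cases[OF \<phi>]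
    proof
      assume "\<phi> = (\<lambda>x\<in>verts ?H. x)"
      then show thesis using that[of i] i by (simp add: vs)
    next
      assume "\<phi> = reflection ?H"
      moreover have "b - 1 - (b - 2 - i) = Suc i" "b - 1 - Suc (b - 2 - i) = i"
        using i by auto
      ultimately show thesis
        using that[of "b - 2 - i"] i by (auto simp: reflection_def vs insert_commute)
    qed
    have "(\<psi> \<circ> \<phi>) ` {j, Suc j} \<in> edges ?G"
      using hom consecutive_in_edges_cycle_mon[OF j(1)] by (simp only: graph_hom_def)
    moreover have "(\<psi> \<circ> \<phi>) ` {j, Suc j} = \<psi> ` {i, Suc i}"
      unfolding image_comp[symmetric] using j(2) by simp
    ultimately have "block_coloring m {\<psi> i, \<psi> (Suc i)} = 2"
      by (simp add: color_subgraph_def)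
    then show ?thesis by (simp add: block_coloring_pair split: if_splits)
  qed
  have "i \<le> \<psi> i div m" if "i < b" for i
    using that
  proof (induction i)
    case (Suc i)
    have "\<psi> i < \<psi> (Suc i)" using \<psi>(2) Suc.prems by (simp add: vs strict_mono_on_def)
    then have "\<psi> i div m \<le> \<psi> (Suc i) div m" by (simp add: div_le_mono)
    then show ?case using Suc blue[of i] by simp
  qed simp
  from this[of "b - 1"] have "m * (b - 1) \<le> \<psi> (b - 1)"
    using assms(1) by (metis div_times_less_eq_dividend diff_less le_trans less_le_trans mult.commute
      mult_le_mono2 zero_less_one)
  moreover have "\<psi> (b - 1) < n"
    using \<psi>(1) assms(1) by (auto simp: vs verts_def color_subgraph_def complete_graph_def)
  ultimately show False using assms(2) by simp
qed

section \<open>The Ramsey number\<close>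

theorem proposition4p12:
  fixes a b :: nat
  assumes "1 \<le> a" and "2 \<le> b"
  shows "ref_ramsey [star_sc a, cycle_mon b] = 1 + (a - 1) * (b - 1)"
proof -
  let ?N = "1 + (a - 1) * (b - 1)"
  define arrows where "arrows n \<longleftrightarrow> (\<forall>c. edge_coloring 2 (complete_graph n) c \<longrightarrow>
    embeddable (star_sc a) (reflection_group (star_sc a)) (color_subgraph (complete_graph n) c 1) \<or>
    embeddable (cycle_mon b) (reflection_group (cycle_mon b))
      (color_subgraph (complete_graph n) c 2))" for n
  have two: "{Suc 0..2} = {1, 2}" by auto
  have "ref_ramsey [star_sc a, cycle_mon b] = Inf {n. 1 \<le> n \<and> arrows n}"
    unfolding ref_ramsey_def perm_ramsey_def arrows_def
    by (simp add: two numeral_2_eq_2[symmetric])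
  also have "\<dots> = ?N"
  proof (rule cInf_eq_minimum)
    show "?N \<in> {n. 1 \<le> n \<and> arrows n}"
      using red_star_or_blue_cycle[OF assms refl] by (simp add: arrows_def)
  next
    fix n assume "n \<in> {n. 1 \<le> n \<and> arrows n}"
    then have n: "1 \<le> n" "arrows n" by auto
    show "?N \<le> n"
    proof (rule ccontr)
      assume "\<not> ?N \<le> n"
      then have small: "n \<le> (a - 1) * (b - 1)" by simp
      \<comment> \<open>Blocks need positive length; for \<open>a = 1\<close> no positive \<open>n\<close> is below the bound.\<close>
      then have "1 \<le> a - 1" using n(1) by (cases "a - 1") auto
      moreover have "edge_coloring 2 (complete_graph n) (block_coloring (a - 1))"
        by (auto simp: edge_coloring_def block_coloring_def)
      ultimately show False
        using n(2) no_red_star[of "a - 1" a n] no_blue_cycle[of b n "a - 1"] small assms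
        by (auto simp: arrows_def)
    qed
  qed
  finally show ?thesis .
qed

end
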